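(* Let $u_0\ge 0$ and let $E^*\subseteq E'\subseteq E$ be such that $E'$ is acyclic and for every $v\in V$ there is a directed path from $s$ to $v$ using only edges of $E'$. Then the labels $\ell'=(\ell'_v)_{v\in V}$ are the same for all normalized thin flows of value $u_0$ with resetting on $E^*\subseteq E'$; that is, if $x'$ and $y'$ are two such normalized thin flows with corresponding labels $\ell'$ and $h'$, then $\ell'_v=h'_v$ for all $v\in V$.
   Context: $G=(V,E)$ is a finite directed graph without loops and with at most one edge from $v$ to $w$ for every pair of nodes; an edge from $v$ to $w$ is written $e=vw$. A source $s\in V$ and a sink $t\in V$, $s\ne t$, are given, together with positive numbers $(\nu_e)_{e\in E}$. Let $u_0\ge 0$ and $E^*\subseteq E'\subseteq E$, with $E'$ acyclic and containing an $s$-$v$ path for every $v\in V$. $K(E',u_0)$ denotes the set of static $s$-$t$ flows of size $u_0$ supported on $E'$: vectors $x'=(x'_e)_{e\in E}$ with $x'_e\ge 0$, $x'_e=0$ for $e\notin E'$, and $\sum_{e\in\delta^+(v)}x'_e-\sum_{e\in\delta^-(v)}x'_e$ equal to $u_0$ for $v=s$, to $-u_0$ for $v=t$, and to $0$ for all other $v$ (here $\delta^+(v),\delta^-(v)$ are the sets of edges leaving and entering $v$). For $e=vw\in E'$ and real numbers $a,b$ set $\rho_e(a,b)=b/\nu_e$ if $e\in E^*$, and $\rho_e(a,b)=\max\{a,b/\nu_e\}$ if $e\notin E^*$. The labels corresponding to $x'\in K(E',u_0)$ are the unique numbers $(\ell'_v)_{v\in V}$ with $\ell'_s=1$ and $\ell'_w=\min_{e=vw\in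 E'}\rho_e(\ell'_v,x'_e)$ for $w\neq s$ (well defined since $E'$ is acyclic). A flow $x'\in K(E',u_0)$ with labels $\ell'$ is a normalized thin flow (NTF) of value $u_0$ with resetting on $E^*\subseteq E'$ if $x'_e=0$ for every edge $e=vw\in E'$ such that $\ell'_w<\rho_e(\ell'_v,x'_e)$. *)

theory Defs
  imports Complex_Main "Graph_Theory.Arc_Walk"
begin

text \<open>
  The numbers \<open>\<nu>\<close>, flows and labels are total functions; only their values on
  \<open>arcs G\<close>, respectively \<open>verts G\<close>, are constrained.
\<close>

definition acyclic_arcs :: "('a, 'b) pre_digraph \<Rightarrow> 'b set \<Rightarrow> bool" where
  "acyclic_arcs G F \<longleftrightarrow> (\<nexists>c. pre_digraph.cycle (G\<lparr>arcs := F\<rparr>) c)"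

definition connects_all :: "('a, 'b) pre_digraph \<Rightarrow> 'a \<Rightarrow> 'b set \<Rightarrow> bool" where
  "connects_all G s F \<longleftrightarrow> (\<forall>v\<in>verts G. \<exists>p. pre_digraph.apath (G\<lparr>arcs := F\<rparr>) s p v)"

definition static_flows ::
  "('a, 'b) pre_digraph \<Rightarrow> 'a \<Rightarrow> 'a \<Rightarrow> 'b set \<Rightarrow> real \<Rightarrow> ('b \<Rightarrow> real) set" where
  "static_flows G s t F u0 = {x.
     (\<forall>e\<in>arcs G. x e \<ge> 0) \<and>
     (\<forall>e\<in>arcs G - F. x e = 0) \<and>
     (\<forall>v\<in>verts G. (\<Sum>e\<in>out_arcs G v. x e) - (\<Sum>e\<in>in_arcs G v. x e) =
        (if v = s then u0 else if v = t then - u0 else 0))}"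

definition rho :: "('b \<Rightarrow> real) \<Rightarrow> 'b set \<Rightarrow> 'b \<Rightarrow> real \<Rightarrow> real \<Rightarrow> real" where
  "rho \<nu> R e a b = (if e \<in> R then b / \<nu> e else max a (b / \<nu> e))"

text \<open>
  If \<open>F\<close> is acyclic and contains a path from \<open>s\<close> to every vertex, then every
  vertex other than \<open>s\<close> has an incoming arc in \<open>F\<close>, so \<open>Min\<close> is taken
  over a nonempty finite set, and such an \<open>l\<close> exists and is unique on \<open>verts G\<close>;
  see \<open>incoming_arc\<close>, \<open>labels_exist\<close> and \<open>labels_unique\<close> below.
\<close>
definition is_labels ::
  "('a, 'b) pre_digraph \<Rightarrow> 'a \<Rightarrow> ('b \<Rightarrow> real) \<Rightarrow> 'b set \<Rightarrow> 'b set \<Rightarrow> ('b \<Rightarrow> real)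
    \<Rightarrow> ('a \<Rightarrow> real) \<Rightarrow> bool" where
  "is_labels G s \<nu> R F x l \<longleftrightarrow>
     l s = 1 \<and>
     (\<forall>w\<in>verts G - {s}.
        l w = Min ((\<lambda>e. rho \<nu> R e (l (tail G e)) (x e)) ` {e \<in> F. head G e = w}))"

lemma wf_arc_rel:
  assumes "digraph G" "F \<subseteq> arcs G" "acyclic_arcs G F"
  shows "wf ((\<lambda>e. (tail G e, head G e)) ` F)"
proof -
  interpret G: digraph G by fact
  let ?H = "G\<lparr>arcs := F\<rparr>"
  interpret H: wf_digraph ?H
    using assms(2) by unfold_locales auto
  have fin: "finite F" using assms(2) G.finite_arcs finite_subset by blast
  have eq: "arcs_ends ?H = (\<lambda>e. (tail G e, head G e)) ` F"
    by (simp add: arcs_ends_conv)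
  have "acyclic (arcs_ends ?H)"
  proof (rule acyclicI, rule allI, rule notI)
    fix v assume "v \<rightarrow>\<^sup>+\<^bsub>?H\<^esub> v"
    then obtain p where "H.awalk v p v" "p \<noteq> []" unfolding H.reachable1_awalk by blast
    then have "H.closed_w p" by (auto simp: H.closed_w_def)
    with assms(3) show False using H.closed_w_imp_cycle by (auto simp: acyclic_arcs_def)
  qed
  then show ?thesis using fin by (simp add: eq finite_acyclic_wf)
qed

lemma labels_exist:
  assumes "digraph G" "F \<subseteq> arcs G" "acyclic_arcs G F"
  shows "\<exists>l. is_labels G s \<nu> R F x l"
proof -
  let ?r = "(\<lambda>e. (tail G e, head G e)) ` F"
  let ?\<Phi> = "\<lambda>l w. if w = s then 1
    else Min ((\<lambda>e. rho \<nu> R e (l (tail G e)) (x e)) ` {e \<in> F. head G e = w})"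
  define l where "l = wfrec ?r ?\<Phi>"
  have rec: "l w = ?\<Phi> (cut l ?r w) w" for w
    unfolding l_def by (subst wfrec[OF wf_arc_rel[OF assms]]) simp
  have "l w = ?\<Phi> l w" for w
  proof -
    have "(\<lambda>e. rho \<nu> R e (cut l ?r w (tail G e)) (x e)) ` {e \<in> F. head G e = w}
      = (\<lambda>e. rho \<nu> R e (l (tail G e)) (x e)) ` {e \<in> F. head G e = w}"
      by (rule image_cong) (auto simp: cut_def)
    then show ?thesis by (subst rec) simp
  qed
  then have "is_labels G s \<nu> R F x l" unfolding is_labels_def by auto
  then show ?thesis by blast
qed

lemma labels_unique:
  assumes "digraph G" "F \<subseteq> arcs G" "acyclic_arcs G F"
    and l: "is_labels G s \<nu> R F x l" and h: "is_labels G s \<nu> R F x h"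
    and "v \<in> verts G"
  shows "l v = h v"
  using \<open>v \<in> verts G\<close>
proof (induction v rule: wf_induct_rule[OF wf_arc_rel[OF assms(1-3)]])
  case (1 w)
  interpret G: digraph G by fact
  have "(\<lambda>e. rho \<nu> R e (l (tail G e)) (x e)) ` {e \<in> F. head G e = w}
      = (\<lambda>e. rho \<nu> R e (h (tail G e)) (x e)) ` {e \<in> F. head G e = w}"
    using 1 assms(2) by (intro image_cong) auto
  then show ?case using l h 1(2) unfolding is_labels_def by (cases "w = s") auto
qed

lemma incoming_arc:
  assumes "connects_all G s F" "v \<in> verts G" "v \<noteq> s"
  shows "{e \<in> F. head G e = v} \<noteq> {}"
proof -
  obtain p where p: "pre_digraph.apath (G\<lparr>arcs := F\<rparr>) s p v"
    using assms by (auto simp: connects_all_def)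
  have *: "pre_digraph.cas H u p w \<Longrightarrow> p \<noteq> [] \<Longrightarrow> head H (last p) = w" for H :: "('a,'b) pre_digraph" and u p w
    by (induction p arbitrary: u) (auto simp: pre_digraph.cas.simps split: if_splits)
  from p have "pre_digraph.cas (G\<lparr>arcs := F\<rparr>) s p v" "set p \<subseteq> F"
    by (auto simp: pre_digraph.apath_def pre_digraph.awalk_def)
  moreover have "p \<noteq> []" using calculation assms(3) by (auto simp: pre_digraph.cas.simps)
  ultimately have "head G (last p) = v" "last p \<in> F" using *[of "G\<lparr>arcs := F\<rparr>" s p v] by auto
  then show ?thesis by blast
qed

definition is_NTF ::
  "('a, 'b) pre_digraph \<Rightarrow> 'a \<Rightarrow> 'a \<Rightarrow> ('b \<Rightarrow> real) \<Rightarrow> real \<Rightarrow> 'b set \<Rightarrow> 'b set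
    \<Rightarrow> ('b \<Rightarrow> real) \<Rightarrow> ('a \<Rightarrow> real) \<Rightarrow> bool" where
  "is_NTF G s t \<nu> u0 R F x l \<longleftrightarrow>
     x \<in> static_flows G s t F u0 \<and>
     is_labels G s \<nu> R F x l \<and>
     (\<forall>e\<in>F. l (head G e) < rho \<nu> R e (l (tail G e)) (x e) \<longrightarrow> x e = 0)"

end

theory Submission
  imports Defs
begin

text \<open>
  Let \<open>l\<close>, \<open>h\<close> be the labels of two thin flows \<open>x\<close>, \<open>y\<close> and suppose that
  \<open>S = {v. h v < l v}\<close> is nonempty; it does not contain \<open>s\<close>. Thinness forces
  \<open>y \<le> x\<close> on the arcs entering \<open>S\<close>, strictly where \<open>y > 0\<close>, and \<open>x \<le> y\<close> on
  the arcs leaving \<open>S\<close>. As both flows have the same net flow across the cut, they agree on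
  the cut, and so both vanish on all entering arcs. A vertex of \<open>S\<close> that is minimal with
  respect to \<open>E'\<close> is reached by entering arcs only, and as \<open>l \<le> h\<close> at their tails, its
  label satisfies \<open>l \<le> h\<close> as well: a contradiction.
\<close>

text \<open>Each arc counts once at its tail and once at its head, so arcs inside \<open>S\<close>
  cancel: the coefficient is 1 on arcs leaving \<open>S\<close>, -1 on arcs entering it and 0 on all
  others.\<close>

lemma (in fin_digraph) sum_net_outflow:
  fixes x :: "'b \<Rightarrow> real"
  assumes "S \<subseteq> verts G"
  shows "(\<Sum>v\<in>S. (\<Sum>e\<in>out_arcs G v. x e) - (\<Sum>e\<in>in_arcs G v. x e)) =
    (\<Sum>e\<in>arcs G. x e * (of_bool (tail G e \<in> S) - of_bool (head G e \<in> S)))"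
proof -
  have fin: "finite S" by (rule finite_subset[OF assms finite_verts])
  have group: "(\<Sum>v\<in>S. \<Sum>e\<in>{e \<in> arcs G. f e = v}. x e) = (\<Sum>e\<in>arcs G. x e * of_bool (f e \<in> S))"
    for f :: "'b \<Rightarrow> 'a"
  proof -
    have "(\<Sum>v\<in>S. \<Sum>e\<in>{e \<in> arcs G. f e = v}. x e)
        = (\<Sum>v\<in>S. \<Sum>e\<in>arcs G. if f e = v then x e else 0)"
      by (simp add: sum.inter_filter)
    also have "\<dots> = (\<Sum>e\<in>arcs G. \<Sum>v\<in>S. if f e = v then x e else 0)"
      by (rule sum.swap)
    also have "\<dots> = (\<Sum>e\<in>arcs G. x e * of_bool (f e \<in> S))"
      using fin by (intro sum.cong) auto
    finally show ?thesis .
  qed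
  show ?thesis
    using group[of "tail G"] group[of "head G"]
    by (simp add: out_arcs_def in_arcs_def sum_subtractf right_diff_distrib)
qed

lemma static_flows_net_outflow_eq:
  assumes "x \<in> static_flows G s t F u" "y \<in> static_flows G s t F u" "v \<in> verts G"
  shows "(\<Sum>e\<in>out_arcs G v. x e) - (\<Sum>e\<in>in_arcs G v. x e) =
    (\<Sum>e\<in>out_arcs G v. y e) - (\<Sum>e\<in>in_arcs G v. y e)"
  using assms by (simp add: static_flows_def)

lemma is_labels_le_rho:
  assumes "is_labels G s \<nu> R F x l" "finite F" "e \<in> F" "head G e \<in> verts G" "head G e \<noteq> s"
  shows "l (head G e) \<le> rho \<nu> R e (l (tail G e)) (x e)"
  using assms by (auto simp: is_labels_def intro!: Min_le)

lemma rho_mono: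
  assumes "a \<le> a'" "b \<le> b'" "\<nu> e > 0"
  shows "rho \<nu> R e a b \<le> rho \<nu> R e a' b'"
  using assms divide_right_mono[of b b' "\<nu> e"] by (auto simp: rho_def)

text \<open>If \<open>e \<notin> R\<close>, the right-hand maximum is at least
  \<open>a > a'\<close>, so it is attained by \<open>b' / \<nu> e\<close>.\<close>

lemma rho_le_rho_imp_le:
  assumes "rho \<nu> R e a b \<le> rho \<nu> R e a' b'" "a' < a" "\<nu> e > 0"
  shows "b \<le> b'"
proof -
  have "b / \<nu> e \<le> b' / \<nu> e"
    using assms(1,2) by (auto simp: rho_def split: if_splits)
  then show ?thesis using assms(3) by (simp add: divide_le_cancel)
qed

text \<open>A label is a minimum over incoming arcs, hence at most \<open>rho\<close>; a strict gap
  would force \<open>x e = 0\<close> by thinness.\<close>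

lemma NTF_rho_eq:
  assumes "is_NTF G s t \<nu> u R F x l" "finite F" "e \<in> F" "head G e \<in> verts G" "head G e \<noteq> s"
    "x e \<noteq> 0"
  shows "rho \<nu> R e (l (tail G e)) (x e) = l (head G e)"
  using assms is_labels_le_rho[of G s \<nu> R F x l e] by (force simp: is_NTF_def)

text \<open>A path from \<open>s\<close> to the tail of \<open>e\<close>, closed up by
  \<open>e\<close>, would give a cycle. Since the minimum formula for labels excludes
  \<open>s\<close>, this is what allows its use at the head of any arc of \<open>F\<close>.\<close>

lemma no_arc_into_source:
  assumes "digraph G" "F \<subseteq> arcs G" "acyclic_arcs G F" "connects_all G s F" "e \<in> F"
  shows "head G e \<noteq> s"
proof
  assume "head G e = s"
  interpret digraph G by fact
  let ?H = "G\<lparr>arcs := F\<rparr>"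
  interpret H: wf_digraph ?H
    using assms(2) by unfold_locales auto
  have ends: "arcs_ends ?H = (\<lambda>e. (tail G e, head G e)) ` F"
    by (simp add: arcs_ends_conv)
  have "tail G e \<in> verts G" using assms(2,5) by auto
  then obtain p where "H.apath s p (tail G e)"
    using assms(4) by (auto simp: connects_all_def)
  then have "s \<rightarrow>\<^sup>*\<^bsub>?H\<^esub> tail G e"
    using H.reachable_apath by blast
  moreover have "tail G e \<rightarrow>\<^bsub>?H\<^esub> s"
    using assms(5) \<open>head G e = s\<close> by (force simp: ends)
  ultimately have "s \<rightarrow>\<^sup>+\<^bsub>?H\<^esub> s"
    by (rule rtrancl_into_trancl1[OF reachable_rtranclI])
  then show False
    using wf_acyclic[OF wf_arc_rel[OF assms(1-3)]] by (simp add: ends acyclic_def)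
qed

lemma NTF_labels_le:
  assumes G: "digraph G"
    and \<nu>: "\<forall>e\<in>arcs G. \<nu> e > 0"
    and F: "F \<subseteq> arcs G" "acyclic_arcs G F" "connects_all G s F"
    and x: "is_NTF G s t \<nu> u R F x l" and y: "is_NTF G s t \<nu> u R F y h"
    and v: "v \<in> verts G"
  shows "l v \<le> h v"
proof (rule ccontr)
  assume "\<not> l v \<le> h v"
  interpret digraph G by fact
  define S where "S = {v \<in> verts G. h v < l v}"
  have S: "S \<subseteq> verts G" "v \<in> S" "s \<notin> S"
    using v \<open>\<not> l v \<le> h v\<close> x y by (auto simp: S_def is_NTF_def is_labels_def)
  have fin: "finite F" by (rule finite_subset[OF F(1) finite_arcs])
  have xl: "x \<in> static_flows G s t F u" "is_labels G s \<nu> R F x l"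
    and yl: "y \<in> static_flows G s t F u" "is_labels G s \<nu> R F y h"
    using x y by (auto simp: is_NTF_def)
  have nonneg: "0 \<le> x e" "0 \<le> y e" if "e \<in> arcs G" for e
    using xl(1) yl(1) that by (auto simp: static_flows_def)
  have off: "x e = 0" "y e = 0" if "e \<in> arcs G" "e \<notin> F" for e
    using xl(1) yl(1) that by (auto simp: static_flows_def)

  have entering: "y e < x e" if e: "e \<in> F" "tail G e \<notin> S" "head G e \<in> S" "y e \<noteq> 0" for e
  proof (rule ccontr)
    assume "\<not> y e < x e"
    have verts: "tail G e \<in> verts G" "head G e \<in> verts G" "head G e \<noteq> s" "\<nu> e > 0"
      using e F(1) S \<nu> by auto
    \<comment> \<open>Since \<open>x e \<le> y e\<close>, and \<open>l \<le> h\<close> at the tail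
      outside \<open>S\<close>, monotonicity of \<open>rho\<close> would give
      \<open>l \<le> h\<close> at the head too.\<close>
    have "l (head G e) \<le> rho \<nu> R e (l (tail G e)) (x e)"
      using is_labels_le_rho[OF xl(2) fin] e verts by blast
    also have "\<dots> \<le> rho \<nu> R e (h (tail G e)) (y e)"
      using e verts \<open>\<not> y e < x e\<close> by (intro rho_mono) (auto simp: S_def)
    also have "\<dots> = h (head G e)"
      using NTF_rho_eq[OF y fin] e verts by blast
    finally show False using e by (simp add: S_def)
  qed

  have leaving: "x e \<le> y e" if e: "e \<in> F" "tail G e \<in> S" "head G e \<notin> S" for e
  proof (cases "x e = 0")
    case True
    then show ?thesis using nonneg e F(1) by auto
  next
    case False
    have verts: "head G e \<in> verts G" "head G e \<noteq> s" "\<nu> e > 0"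
      using e F(1) \<nu> no_arc_into_source[OF G F] by auto
    \<comment> \<open>The head lies outside \<open>S\<close>, so the \<open>rho\<close> value does
      not drop from \<open>x\<close> to \<open>y\<close>, although the tail label does; only the
      flow can account for this.\<close>
    have "rho \<nu> R e (l (tail G e)) (x e) = l (head G e)"
      using NTF_rho_eq[OF x fin] e verts False by blast
    also have "\<dots> \<le> h (head G e)"
      using e verts by (auto simp: S_def)
    also have "\<dots> \<le> rho \<nu> R e (h (tail G e)) (y e)"
      using is_labels_le_rho[OF yl(2) fin] e verts False by blast
    finally have "rho \<nu> R e (l (tail G e)) (x e) \<le> rho \<nu> R e (h (tail G e)) (y e)" .
    moreover have "h (tail G e) < l (tail G e)"
      using e by (simp add: S_def)
    ultimately show ?thesis
      using verts(3) by (rule rho_le_rho_imp_le)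
  qed

  \<comment> \<open>The signs match: \<open>y \<le> x\<close> where the coefficient is -1, and
    \<open>x \<le> y\<close> where it is 1.\<close>
  have term_nonneg: "0 \<le> (y e - x e) * (of_bool (tail G e \<in> S) - of_bool (head G e \<in> S))"
    if "e \<in> arcs G" for e
    using that nonneg[of e] off[of e] entering[of e] leaving[of e]
    by (cases "e \<in> F"; cases "y e = 0"; cases "tail G e \<in> S"; cases "head G e \<in> S") auto
  have "(\<Sum>e\<in>arcs G. (y e - x e) * (of_bool (tail G e \<in> S) - of_bool (head G e \<in> S))) = 0"
  proof -
    have "(\<Sum>v\<in>S. (\<Sum>e\<in>out_arcs G v. x e) - (\<Sum>e\<in>in_arcs G v. x e)) =
        (\<Sum>v\<in>S. (\<Sum>e\<in>out_arcs G v. y e) - (\<Sum>e\<in>in_arcs G v. y e))"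
      using static_flows_net_outflow_eq[OF xl(1) yl(1)] S(1) by (intro sum.cong) auto
    then show ?thesis
      unfolding sum_net_outflow[OF S(1)] by (simp add: left_diff_distrib sum_subtractf)
  qed
  then have cut: "(y e - x e) * (of_bool (tail G e \<in> S) - of_bool (head G e \<in> S)) = 0"
    if "e \<in> arcs G" for e
    using that term_nonneg by (subst (asm) sum_nonneg_eq_0_iff) auto
  \<comment> \<open>On an entering arc \<open>cut\<close> gives \<open>x e = y e\<close>, which
    contradicts the strict inequality unless \<open>y e = 0\<close>.\<close>
  have zero: "x e = 0 \<and> y e = 0" if "e \<in> F" "tail G e \<notin> S" "head G e \<in> S" for e
    using cut[OF subsetD[OF F(1) that(1)]] entering[of e] that by (cases "y e = 0") auto

  obtain w where w: "w \<in> S" "\<And>u. (u, w) \<in> (\<lambda>e. (tail G e, head G e)) ` F \<Longrightarrow> u \<notin> S"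
    using wfE_min[OF wf_arc_rel[OF G F(1,2)] S(2)] by blast
  let ?I = "{e \<in> F. head G e = w}"
  have w': "w \<in> verts G" "w \<noteq> s" using w(1) S by auto
  have "h w = Min ((\<lambda>e. rho \<nu> R e (h (tail G e)) (y e)) ` ?I)"
    using yl(2) w' by (simp add: is_labels_def)
  also have "\<dots> \<in> (\<lambda>e. rho \<nu> R e (h (tail G e)) (y e)) ` ?I"
    \<comment> \<open>The set \<open>?I\<close> is nonempty, so some arc attains the minimum that
      defines \<open>h w\<close>.\<close>
    using fin incoming_arc[OF F(3) w'] by (intro Min_in) auto
  finally obtain e where e: "e \<in> F" "head G e = w" "h w = rho \<nu> R e (h (tail G e)) (y e)"
    by blast
  have tail: "tail G e \<notin> S" using w(2) e by blast
  have "l w \<le> rho \<nu> R e (l (tail G e)) (x e)"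
    using is_labels_le_rho[OF xl(2) fin e(1)] e(2) w' by simp
  \<comment> \<open>Both flows vanish on \<open>e\<close>, so only the tail labels differ, and there
    \<open>l \<le> h\<close>.\<close>
  also have "\<dots> \<le> rho \<nu> R e (h (tail G e)) (y e)"
    using zero[OF e(1) tail] e(1,2) w(1) tail F(1) \<nu> by (intro rho_mono) (auto simp: S_def)
  finally show False using e(3) w(1) by (simp add: S_def)
qed

theorem theorem9:
  fixes G :: "('a, 'b) pre_digraph"
    and s t :: 'a
    and \<nu> :: "'b \<Rightarrow> real"
    and u0 :: real
    and Estar E' :: "'b set"
    and x' y' :: "'b \<Rightarrow> real"
    and l' h' :: "'a \<Rightarrow> real"
  assumes "digraph G"
    and "s \<in> verts G" and "t \<in> verts G" and "s \<noteq> t"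
    and "\<forall>e\<in>arcs G. \<nu> e > 0"
    and "u0 \<ge> 0"
    and "Estar \<subseteq> E'" and "E' \<subseteq> arcs G"
    and "acyclic_arcs G E'"
    and "connects_all G s E'"
    and "is_NTF G s t \<nu> u0 Estar E' x' l'"
    and "is_NTF G s t \<nu> u0 Estar E' y' h'"
  shows "\<forall>v\<in>verts G. l' v = h' v"
proof
  fix v assume v: "v \<in> verts G"
  \<comment> \<open>The flows are left open, so that exchanging their roles yields the reverse
    inequality.\<close>
  note le = NTF_labels_le[OF assms(1,5,8,9,10) _ _ v]
  show "l' v = h' v"
    using le[OF assms(11,12)] le[OF assms(12,11)] by simp
qed

end
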